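(* There is an absolute constant $C > 0$ such that for every integer $k \geq 4$ there is $n_0 = n_0(k)$ such that for all integers $m, n \geq n_0$ with $n^{1/2} \leq m \leq n$ there exists an arrangement $(P,L)$ of $m$ points and $n$ lines in $\mathbb{R}^3$ (so $|P| = m$ and $|L| = n$) that contains no $k$-clique in general position, has at most $\sqrt{n}$ lines of $L$ in any common plane, and satisfies $|I(P,L)| > m^{1/2 - C/k}\, n^{3/4}$.
   Context: A point-line arrangement $(P,L)$ in $\mathbb{R}^d$ is a pair consisting of a finite set $P$ of points and a finite set $L$ of lines in $\mathbb{R}^d$. $I(P,L)$ denotes the set of incidences, i.e. pairs $(p,\ell)\in P\times L$ with $p\in\ell$. A $k$-clique of $(P,L)$ is a $k$-element subset of $P$ such that each pair of its points is incident to a common line of $L$. A $k$-clique $\tau$ in $\mathbb{R}^d$ is in general position if no hyperplane contains $d+1$ points of $\tau$; thus in $\mathbb{R}^3$ this means that no four points of $\tau$ are coplanar. *)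

theory Defs
  imports "HOL-Analysis.Analysis"
begin

definition is_line :: "'a::euclidean_space set \<Rightarrow> bool" where
  "is_line l \<longleftrightarrow> affine l \<and> aff_dim l = 1"

definition is_plane :: "'a::euclidean_space set \<Rightarrow> bool" where
  "is_plane H \<longleftrightarrow> affine H \<and> aff_dim H = 2"

definition is_hyperplane :: "'a::euclidean_space set \<Rightarrow> bool" where
  "is_hyperplane H \<longleftrightarrow> affine H \<and> aff_dim H = int DIM('a) - 1"

definition arrangement :: "'a::euclidean_space set \<Rightarrow> 'a set set \<Rightarrow> bool" where
  "arrangement P L \<longleftrightarrow> finite P \<and> finite L \<and> (\<forall>l\<in>L. is_line l)"

definition incidences :: "'a set \<Rightarrow> 'a set set \<Rightarrow> ('a \<times> 'a set) set" where
  "incidences P L = {(p, l). p \<in> P \<and> l \<in> L \<and> p \<in> l}"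

text \<open>A pair of points is a pair of distinct points. The line joining them may
  depend on the pair.\<close>

definition is_clique :: "nat \<Rightarrow> 'a set \<Rightarrow> 'a set set \<Rightarrow> 'a set \<Rightarrow> bool" where
  "is_clique k P L T \<longleftrightarrow> T \<subseteq> P \<and> finite T \<and> card T = k \<and>
     (\<forall>p\<in>T. \<forall>q\<in>T. p \<noteq> q \<longrightarrow> (\<exists>l\<in>L. p \<in> l \<and> q \<in> l))"

definition general_position :: "'a::euclidean_space set \<Rightarrow> bool" where
  "general_position T \<longleftrightarrow>
     \<not> (\<exists>H S. is_hyperplane H \<and> S \<subseteq> T \<and> card S = DIM('a) + 1 \<and> S \<subseteq> H)"

end

theory Submission
  imports Defs
begin

text \<open>
  The proof starts from a grid arrangement attaining the order \<open>m\<^sup>1\<^sup>/\<^sup>2 n\<^sup>3\<^sup>/\<^sup>4\<close> and destroys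
  its cliques by discarding lines at random. The grid consists of the lines \<open>x = az + b\<close>,
  \<open>y = cz + d\<close> with integers \<open>0 \<le> a, c < A\<close> and \<open>0 \<le> b, d < AN\<close>, together with the lattice points
  \<open>0 \<le> x, y < 2AN\<close>, \<open>0 \<le> z < N\<close>. There are \<open>A\<^sup>4N\<^sup>2\<close> lines with \<open>N\<close> points on each, and at most
  \<open>4A\<^sup>2N\<^sup>3\<close> points, so varying \<open>N\<close> covers the whole range of \<open>m\<close> between \<open>n\<^sup>1\<^sup>/\<^sup>2\<close> and \<open>n\<close>.
  A plane contains at most \<open>A\<^sup>2N\<close> of the lines, the square root of their number
  (\<open>card_grid_lines_in_plane\<close>).

  Cliques in general position are cheap to remove: such a \<open>k\<close>-clique has only \<open>k\<close> points but
  \<open>k(k-1)/2\<close> distinct joining lines, because no three of its points are collinear. Colour the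
  lines with \<open>t\<close> colours at random. The joining lines of a given clique all receive the same
  colour with probability \<open>t\<close> to the power \<open>1 - k(k-1)/2\<close>, and there are at most \<open>m\<^sup>k\<close> cliques, so
  some colouring has no monochromatic clique once \<open>t\<close> is of order \<open>m\<^sup>4\<^sup>/\<^sup>k\<close>. Its largest colour
  class contains no clique in general position and retains a fraction \<open>1/t\<close> of the lines, hence
  of the incidences (\<open>exists_clique_free_sublines\<close>).

  The numbers of points and lines are finally raised to \<open>m\<close> and \<open>n\<close> by objects that take part
  in no incidence: pairwise skew lines that miss the points, which add at most one line to each
  plane, and points off all lines (\<open>pad_arrangement\<close>). A clique cannot use them. The constants
  lost in rounding are absorbed by a further factor \<open>m\<^sup>1\<^sup>/\<^sup>k\<close>, which gives \<open>C = 4 + 1\<close>.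
\<close>

section \<open>Large sets avoiding a small family of subsets\<close>

lemma card_monochromatic_colourings:
  fixes X :: "'a set" and t :: nat
  assumes "finite X" "S \<subseteq> X"
  shows "card {c \<in> X \<rightarrow>\<^sub>E {..<t}. \<exists>i<t. \<forall>x\<in>S. c x = i} \<le> t * t ^ (card X - card S)"
proof -
  let ?D = "{..<t} \<times> ((X - S) \<rightarrow>\<^sub>E {..<t})"
  let ?ext = "\<lambda>(i, g). \<lambda>x. if x \<in> S then i else g x"
  have fin: "finite ?D"
    using assms by (intro finite_cartesian_product finite_PiE) auto
  have sub: "{c \<in> X \<rightarrow>\<^sub>E {..<t}. \<exists>i<t. \<forall>x\<in>S. c x = i} \<subseteq> ?ext ` ?D"
  proof
    fix c assume "c \<in> {c \<in> X \<rightarrow>\<^sub>E {..<t}. \<exists>i<t. \<forall>x\<in>S. c x = i}"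
    then obtain i where c: "c \<in> X \<rightarrow>\<^sub>E {..<t}" and i: "i < t" "\<forall>x\<in>S. c x = i"
      by blast
    have "restrict c (X - S) \<in> (X - S) \<rightarrow>\<^sub>E {..<t}"
      using c by (auto simp: PiE_iff)
    moreover have "c = ?ext (i, restrict c (X - S))"
      using c i assms by (auto simp: fun_eq_iff PiE_iff extensional_def)
    ultimately show "c \<in> ?ext ` ?D"
      using i(1) by (intro image_eqI[of _ _ "(i, restrict c (X - S))"]) auto
  qed
  have "card {c \<in> X \<rightarrow>\<^sub>E {..<t}. \<exists>i<t. \<forall>x\<in>S. c x = i} \<le> card (?ext ` ?D)"
    using fin sub by (intro card_mono) auto
  also have "\<dots> \<le> card ?D"
    using fin by (rule card_image_le)
  also have "\<dots> = t * t ^ (card X - card S)"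
    using assms finite_subset[OF assms(2,1)]
    by (simp add: card_cartesian_product card_PiE card_Diff_subset)
  finally show ?thesis .
qed

text \<open>A uniformly random \<open>t\<close>-colouring makes a given \<open>q\<close>-set monochromatic with probability
  \<open>t\<^sup>1\<^sup>-\<^sup>q\<close>, so fewer than \<open>t\<^sup>q\<^sup>-\<^sup>1\<close> such sets can all be made non-monochromatic at once.
  A most frequent colour class then avoids all of them.\<close>

lemma exists_large_subset_avoiding:
  fixes X :: "'a set" and F :: "'a set set" and t q :: nat
  assumes X: "finite X" and F: "\<And>S. S \<in> F \<Longrightarrow> S \<subseteq> X \<and> card S = q"
    and few: "card F < t ^ (q - 1)" and "0 < q" "0 < t"
  obtains Y where "Y \<subseteq> X" "card X \<le> t * card Y" "\<And>S. S \<in> F \<Longrightarrow> \<not> S \<subseteq> Y"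
proof -
  let ?mono = "\<lambda>S. {c \<in> X \<rightarrow>\<^sub>E {..<t}. \<exists>i<t. \<forall>x\<in>S. c x = i}"
  have finF: "finite F"
    using F X by (intro finite_subset[of F "Pow X"]) auto
  have finE: "finite (X \<rightarrow>\<^sub>E {..<t})"
    using X by (intro finite_PiE) auto
  have "card (\<Union>S\<in>F. ?mono S) < card (X \<rightarrow>\<^sub>E {..<t})"
  proof (cases "F = {}")
    case True
    then show ?thesis using X \<open>0 < t\<close> by (simp add: card_PiE)
  next
    case False
    then obtain S where "S \<in> F" by blast
    then have qX: "q \<le> card X" using F card_mono[OF X] by metis
    have "card (\<Union>S\<in>F. ?mono S) \<le> (\<Sum>S\<in>F. card (?mono S))"
      using finF by (rule card_UN_le)
    also have "\<dots> \<le> (\<Sum>S\<in>F. t * t ^ (card X - q))"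
      using F card_monochromatic_colourings[OF X] by (intro sum_mono) fastforce
    also have "\<dots> = card F * (t * t ^ (card X - q))"
      by simp
    also have "\<dots> < t ^ (q - 1) * (t * t ^ (card X - q))"
      using few \<open>0 < t\<close> by (intro mult_strict_right_mono) auto
    also have "\<dots> = t ^ ((q - 1) + 1 + (card X - q))"
      by (simp add: power_add)
    also have "(q - 1) + 1 + (card X - q) = card X"
      using qX \<open>0 < q\<close> by simp
    also have "t ^ card X = card (X \<rightarrow>\<^sub>E {..<t})"
      using X by (simp add: card_PiE)
    finally show ?thesis .
  qed
  moreover have "finite (\<Union>S\<in>F. ?mono S)"
    using finE finF by simp
  ultimately have "\<not> (X \<rightarrow>\<^sub>E {..<t}) \<subseteq> (\<Union>S\<in>F. ?mono S)"
    using card_mono[of "\<Union>S\<in>F. ?mono S" "X \<rightarrow>\<^sub>E {..<t}"] by (intro notI) simp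
  then obtain c where c: "c \<in> X \<rightarrow>\<^sub>E {..<t}" and "c \<notin> (\<Union>S\<in>F. ?mono S)"
    unfolding subset_eq ball_simps by (elim bexE)
  then have good: "c \<notin> ?mono S" if "S \<in> F" for S
    using that by blast
  let ?cls = "\<lambda>i. {x \<in> X. c x = i}"
  have "\<exists>i<t. card X \<le> t * card (?cls i)"
  proof (rule ccontr)
    assume "\<not> ?thesis"
    then have less: "\<And>i. i < t \<Longrightarrow> t * card (?cls i) < card X"
      by (meson not_less)
    have "card X = card (\<Union>i<t. ?cls i)"
      using c by (intro arg_cong[of _ _ card]) (auto simp: PiE_iff)
    also have "\<dots> \<le> (\<Sum>i<t. card (?cls i))"
      by (rule card_UN_le) auto
    finally have "t * card X \<le> (\<Sum>i<t. t * card (?cls i))"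
      by (simp add: sum_distrib_left[symmetric])
    also have "\<dots> < (\<Sum>i<t. card X)"
      using less \<open>0 < t\<close> by (intro sum_strict_mono) auto
    finally show False by simp
  qed
  then obtain i where i: "i < t" "card X \<le> t * card (?cls i)" by blast
  show ?thesis
  proof (rule that[of "?cls i"])
    show "\<not> S \<subseteq> ?cls i" if "S \<in> F" for S
      using good[OF that] c i(1) by blast
  qed (use i in auto)
qed

section \<open>Thinning out the lines of an arrangement\<close>

lemma line_eq_affine_hull:
  fixes l :: "'a::euclidean_space set"
  assumes "is_line l" "p \<in> l" "q \<in> l" "p \<noteq> q"
  shows "l = affine hull {p, q}"
proof -
  have "affine hull {p, q} \<subseteq> l"
    using assms by (intro hull_minimal) (auto simp: is_line_def)
  moreover have "aff_dim (affine hull {p, q}) = aff_dim l"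
    using assms by (simp add: is_line_def aff_dim_2)
  ultimately show ?thesis
    using assms affine_dim_equal[of "affine hull {p, q}" l]
    by (auto simp: is_line_def)
qed

lemma aff_dim_union_finite_le:
  fixes A B :: "'a::euclidean_space set"
  assumes "finite B"
  shows "aff_dim (A \<union> B) \<le> aff_dim A + int (card B)"
  using assms
proof induction
  case (insert x B)
  have "aff_dim (insert x (A \<union> B)) \<le> aff_dim (A \<union> B) + 1"
    by (simp add: aff_dim_insert)
  then show ?case using insert by simp
qed simp

text \<open>Three collinear points span only a line, so together with any \<open>d - 2\<close> further points
  they would be \<open>d + 1\<close> points in a hyperplane.\<close>

lemma general_position_no_three_collinear:
  fixes T :: "'a::euclidean_space set"
  assumes gp: "general_position T" and T: "finite T" "DIM('a) < card T" and d: "2 \<le> DIM('a)"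
    and pqr: "p \<in> T" "q \<in> T" "r \<in> T" "p \<noteq> q" "r \<noteq> p" "r \<noteq> q"
  shows "r \<notin> affine hull {p, q}"
proof
  assume r: "r \<in> affine hull {p, q}"
  have card3: "card {p, q, r} = 3" using pqr by auto
  have "DIM('a) - 2 \<le> card (T - {p, q, r})"
    using T d pqr card3 by (subst card_Diff_subset) auto
  then obtain B where B: "B \<subseteq> T - {p, q, r}" "card B = DIM('a) - 2" "finite B"
    by (meson obtain_subset_with_card_n)
  have "aff_dim {p, q, r} = aff_dim {p, q}"
    using r by (metis aff_dim_insert insert_commute)
  then have "aff_dim {p, q, r} = 1"
    using pqr by (simp add: aff_dim_2)
  then have "aff_dim ({p, q, r} \<union> B) < int DIM('a)"
    using aff_dim_union_finite_le[OF B(3), of "{p, q, r}"] B(2) d by simp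
  then obtain a b where ab: "a \<noteq> 0" "{p, q, r} \<union> B \<subseteq> {x. a \<bullet> x = b}"
    using aff_lowdim_subset_hyperplane by blast
  have "is_hyperplane {x. a \<bullet> x = b}"
    using ab(1) by (simp add: is_hyperplane_def affine_hyperplane)
  moreover have "card ({p, q, r} \<union> B) = DIM('a) + 1"
    using B d card3 by (subst card_Un_disjoint) auto
  moreover have "{p, q, r} \<union> B \<subseteq> T" using B pqr by auto
  ultimately show False
    using gp ab(2) unfolding general_position_def by blast
qed

definition joining_lines :: "'a::euclidean_space set \<Rightarrow> 'a set set" where
  "joining_lines T = (\<lambda>e. affine hull e) ` {e. e \<subseteq> T \<and> card e = 2}"

lemma card_joining_lines:
  fixes T :: "'a::euclidean_space set"
  assumes gp: "general_position T" and T: "finite T" "DIM('a) < card T" and d: "2 \<le> DIM('a)"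
  shows "card (joining_lines T) = card T choose 2"
proof -
  have sub: "e' \<subseteq> e" if e: "e \<subseteq> T" "card e = 2" "e' \<subseteq> T" "affine hull e = affine hull e'" for e e'
  proof
    fix r assume r: "r \<in> e'"
    obtain p q where pq: "e = {p, q}" "p \<noteq> q" using e(2) by (auto simp: card_2_iff)
    have "r \<in> affine hull {p, q}" using r e(4) pq by (metis hull_inc)
    then show "r \<in> e"
      using general_position_no_three_collinear[OF gp T d, of p q r] e r pq by auto
  qed
  have "inj_on (\<lambda>e. affine hull e) {e. e \<subseteq> T \<and> card e = 2}"
    by (rule inj_onI) (use sub in \<open>blast intro: equalityI\<close>)
  then show ?thesis
    using T by (simp add: joining_lines_def card_image n_subsets)
qed

lemma joining_lines_of_clique:
  assumes "is_clique k P L T" "\<forall>l\<in>L. is_line l"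
  shows "joining_lines T \<subseteq> L"
proof
  fix l assume "l \<in> joining_lines T"
  then obtain p q where pq: "p \<in> T" "q \<in> T" "p \<noteq> q" "l = affine hull {p, q}"
    by (auto simp: joining_lines_def card_2_iff)
  then obtain l' where "l' \<in> L" "p \<in> l'" "q \<in> l'"
    using assms(1) unfolding is_clique_def by blast
  then show "l \<in> L" using line_eq_affine_hull pq assms(2) by metis
qed

text \<open>A \<open>k\<close>-clique in general position has only \<open>k\<close> points but \<open>k(k-1)/2\<close> distinct joining
  lines. There are at most \<open>|P|\<^sup>k\<close> cliques to destroy while each one survives a random choice of
  the lines with probability exponential in \<open>-k\<^sup>2\<close>; this is why keeping a fraction
  \<open>|P|\<close> to the power \<open>-O(1/k)\<close> of the lines suffices.\<close>

lemma exists_clique_free_sublines: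
  fixes P :: "'a::euclidean_space set"
  assumes arr: "arrangement P L" and d: "2 \<le> DIM('a)" "DIM('a) < k"
    and few: "card P ^ k < t ^ ((k choose 2) - 1)" and "0 < t"
  obtains L' where "L' \<subseteq> L" "card L \<le> t * card L'"
    "\<And>T. is_clique k P L' T \<Longrightarrow> \<not> general_position T"
proof -
  let ?K = "{T. is_clique k P L T \<and> general_position T}"
  let ?F = "joining_lines ` ?K"
  have fin: "finite P" "finite L" and lines: "\<forall>l\<in>L. is_line l"
    using arr by (auto simp: arrangement_def)
  have sub: "?K \<subseteq> {T. T \<subseteq> P \<and> card T = k}"
    by (auto simp: is_clique_def)
  have finT: "finite {T. T \<subseteq> P \<and> card T = k}"
    using fin by simp
  have "card ?F \<le> card ?K"
    using finite_subset[OF sub finT] by (rule card_image_le)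
  also have "\<dots> \<le> card {T. T \<subseteq> P \<and> card T = k}"
    using sub finT by (intro card_mono)
  also have "\<dots> = card P choose k"
    using fin by (simp add: n_subsets)
  also have "\<dots> \<le> card P ^ k"
    by (cases "k \<le> card P") (auto simp: binomial_le_pow binomial_eq_0)
  finally have "card ?F < t ^ ((k choose 2) - 1)"
    using few by simp
  moreover have "S \<subseteq> L \<and> card S = k choose 2" if "S \<in> ?F" for S
    using that joining_lines_of_clique[OF _ lines] card_joining_lines[OF _ _ _ d(1)] d(2)
    by (auto simp: is_clique_def)
  moreover have "0 < k choose 2" using d by simp
  ultimately obtain L' where L': "L' \<subseteq> L" "card L \<le> t * card L'"
      "\<And>S. S \<in> ?F \<Longrightarrow> \<not> S \<subseteq> L'"
    using exists_large_subset_avoiding[OF fin(2), of ?F "k choose 2" t] \<open>0 < t\<close> by blast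
  show ?thesis
  proof (rule that[OF L'(1,2)])
    fix T assume T: "is_clique k P L' T"
    then have "is_clique k P L T" using L'(1) unfolding is_clique_def by blast
    moreover have "joining_lines T \<subseteq> L'"
      using joining_lines_of_clique[OF T] lines L'(1) by blast
    ultimately show "\<not> general_position T" using L'(3) by blast
  qed
qed

section \<open>The grid arrangement in space\<close>

lemma is_line_range:
  fixes p v :: "'a::euclidean_space"
  assumes "v \<noteq> 0"
  shows "is_line (range (\<lambda>t. p + t *\<^sub>R v))"
proof -
  have "range (\<lambda>t. p + t *\<^sub>R v) = affine hull {p, p + v}"
    by (simp add: affine_hull_2_alt)
  then show ?thesis using assms by (simp add: is_line_def aff_dim_2)
qed

lemma is_plane_equation:
  fixes H :: "(real^3) set"
  assumes "is_plane H"
  obtains \<alpha> \<beta> \<gamma> \<delta> where "H = {p. \<alpha> * p$1 + \<beta> * p$2 + \<gamma> * p$3 = \<delta>}"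
    "\<alpha> \<noteq> 0 \<or> \<beta> \<noteq> 0 \<or> \<gamma> \<noteq> 0"
proof -
  have hull: "affine hull H = H" and dim: "aff_dim H = int (DIM(real^3) - 1)"
    using assms by (simp_all add: is_plane_def affine_hull_eq)
  have "\<exists>a b. a \<noteq> 0 \<and> affine hull H = {x. a \<bullet> x = b}"
    by (rule iffD1[OF aff_dim_eq_hyperplane dim])
  then obtain a b where "a \<noteq> 0" "H = {x. a \<bullet> x = b}"
    unfolding hull by (elim exE conjE)
  moreover have "{x. a \<bullet> x = b} = {p. a$1 * p$1 + a$2 * p$2 + a$3 * p$3 = b}"
    by (simp add: inner_vec_def sum_3)
  ultimately show ?thesis
    by (intro that[of "a$1" "a$2" "a$3" b]) (simp_all add: vec_eq_iff forall_3)
qed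

definition graph_line :: "real \<Rightarrow> real \<Rightarrow> real \<Rightarrow> real \<Rightarrow> (real^3) set" where
  "graph_line a b c d = {p. p$1 = a * p$3 + b \<and> p$2 = c * p$3 + d}"

lemma is_line_graph_line: "is_line (graph_line a b c d)"
proof -
  have "graph_line a b c d = range (\<lambda>t. vector [b, d, 0] + t *\<^sub>R vector [a, c, 1])"
  proof (intro equalityI subsetI)
    fix p assume "p \<in> graph_line a b c d"
    then have "p = vector [b, d, 0] + p$3 *\<^sub>R vector [a, c, 1]"
      by (simp add: graph_line_def vec_eq_iff forall_3 vector_3)
    then show "p \<in> range (\<lambda>t. vector [b, d, 0] + t *\<^sub>R vector [a, c, 1])" by blast
  qed (auto simp: graph_line_def vector_3)
  moreover have "vector [a, c, 1] \<noteq> (0 :: real^3)"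
    by (simp add: vec_eq_iff forall_3 vector_3)
  ultimately show ?thesis using is_line_range by metis
qed

lemma graph_line_subset_plane_iff:
  "graph_line a b c d \<subseteq> {p. \<alpha> * p$1 + \<beta> * p$2 + \<gamma> * p$3 = \<delta>} \<longleftrightarrow>
     \<alpha> * a + \<beta> * c + \<gamma> = 0 \<and> \<alpha> * b + \<beta> * d = \<delta>" (is "?L \<longleftrightarrow> ?R")
proof
  assume ?L
  moreover have "vector [b, d, 0] \<in> graph_line a b c d"
    "vector [a + b, c + d, 1] \<in> graph_line a b c d"
    by (auto simp: graph_line_def vector_3)
  ultimately have "vector [b, d, 0] \<in> {p::real^3. \<alpha> * p$1 + \<beta> * p$2 + \<gamma> * p$3 = \<delta>}"
    "vector [a + b, c + d, 1] \<in> {p::real^3. \<alpha> * p$1 + \<beta> * p$2 + \<gamma> * p$3 = \<delta>}"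
    by (blast dest: subsetD)+
  then have "\<alpha> * b + \<beta> * d = \<delta>" "\<alpha> * (a + b) + \<beta> * (c + d) + \<gamma> = \<delta>"
    by (simp_all add: vector_3)
  then show ?R by (simp add: algebra_simps)
next
  assume R: ?R
  show ?L
  proof (clarsimp simp: graph_line_def)
    fix p :: "real^3"
    have "\<alpha> * (a * p$3 + b) + \<beta> * (c * p$3 + d) + \<gamma> * p$3
        = (\<alpha> * a + \<beta> * c + \<gamma>) * p$3 + (\<alpha> * b + \<beta> * d)"
      by (simp add: algebra_simps)
    then show "\<alpha> * (a * p$3 + b) + \<beta> * (c * p$3 + d) + \<gamma> * p$3 = \<delta>"
      using R by simp
  qed
qed

lemma graph_line_eq_iff:
  "graph_line a b c d = graph_line a' b' c' d' \<longleftrightarrow> a = a' \<and> b = b' \<and> c = c' \<and> d = d'"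
proof
  assume eq: "graph_line a b c d = graph_line a' b' c' d'"
  have "vector [b, d, 0] \<in> graph_line a b c d" "vector [a + b, c + d, 1] \<in> graph_line a b c d"
    by (auto simp: graph_line_def vector_3)
  then show "a = a' \<and> b = b' \<and> c = c' \<and> d = d'"
    unfolding eq by (auto simp: graph_line_def vector_3)
qed simp

definition grid_coeffs :: "nat \<Rightarrow> nat \<Rightarrow> (nat \<times> nat \<times> nat \<times> nat) set" where
  "grid_coeffs A N = {..<A} \<times> {..<A*N} \<times> {..<A} \<times> {..<A*N}"

definition coeff_line :: "nat \<times> nat \<times> nat \<times> nat \<Rightarrow> (real^3) set" where
  "coeff_line = (\<lambda>(a, b, c, d). graph_line a b c d)"

definition grid_lines :: "nat \<Rightarrow> nat \<Rightarrow> (real^3) set set" where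
  "grid_lines A N = coeff_line ` grid_coeffs A N"

text \<open>The box is just large enough for a line with coefficients in \<open>grid_coeffs A N\<close> to
  stay inside it at all heights \<open>0, \<dots>, N - 1\<close>.\<close>

definition grid_points :: "nat \<Rightarrow> nat \<Rightarrow> (real^3) set" where
  "grid_points A N =
     (\<lambda>(x, y, z). vector [real x, real y, real z]) ` ({..<2*A*N} \<times> {..<2*A*N} \<times> {..<N})"

lemma arrangement_grid: "arrangement (grid_points A N) (grid_lines A N)"
  unfolding arrangement_def
proof (intro conjI ballI)
  show "finite (grid_points A N)" "finite (grid_lines A N)"
    by (simp_all add: grid_points_def grid_lines_def grid_coeffs_def)
  show "is_line l" if "l \<in> grid_lines A N" for l
    using that by (auto simp: grid_lines_def coeff_line_def is_line_graph_line)
qed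

lemma inj_coeff_line: "inj coeff_line"
  by (simp add: inj_def coeff_line_def graph_line_eq_iff)

lemma card_grid_lines: "card (grid_lines A N) = A^4 * N^2"
proof -
  have "card (grid_lines A N) = card (grid_coeffs A N)"
    unfolding grid_lines_def by (rule card_image) (rule inj_on_subset[OF inj_coeff_line subset_UNIV])
  then show ?thesis by (simp add: grid_coeffs_def card_cartesian_product power4_eq_xxxx power2_eq_square)
qed

lemma card_grid_points_le: "card (grid_points A N) \<le> 4 * A^2 * N^3"
proof -
  have "card (grid_points A N) \<le> card ({..<2*A*N} \<times> {..<2*A*N} \<times> {..<N})"
    unfolding grid_points_def by (rule card_image_le) simp
  then show ?thesis by (simp add: power3_eq_cube power2_eq_square algebra_simps)
qed

lemma card_grid_points_on_line:
  assumes "l \<in> grid_lines A N"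
  shows "N \<le> card {p \<in> grid_points A N. p \<in> l}"
proof -
  obtain a b c d where l: "l = graph_line (real a) (real b) (real c) (real d)"
      and abcd: "a < A" "b < A*N" "c < A" "d < A*N"
    using assms by (auto simp: grid_lines_def grid_coeffs_def coeff_line_def)
  let ?f = "\<lambda>z::nat. vector [real (a*z+b), real (c*z+d), real z] :: real^3"
  have bound: "e * z + f < 2*A*N" if "e < A" "f < A*N" "z < N" for e f z
  proof -
    have "e * z \<le> A * N" using that by (intro mult_mono) auto
    then show ?thesis using that by linarith
  qed
  have "?f ` {..<N} \<subseteq> {p \<in> grid_points A N. p \<in> l}"
  proof
    fix p assume "p \<in> ?f ` {..<N}"
    then obtain z where z: "z < N" "p = ?f z" by blast
    then have "p \<in> grid_points A N"
      unfolding grid_points_def using bound abcd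
      by (intro image_eqI[of _ _ "(a*z+b, c*z+d, z)"]) auto
    then show "p \<in> {p \<in> grid_points A N. p \<in> l}"
      using z by (simp add: l graph_line_def vector_3)
  qed
  moreover have "inj_on ?f {..<N}"
  proof (rule inj_onI)
    fix z z' assume "?f z = ?f z'"
    then have "?f z $ 3 = ?f z' $ 3" by (rule arg_cong)
    then show "z = z'" by (simp only: vector_3 of_nat_eq_iff)
  qed
  moreover have "finite {p \<in> grid_points A N. p \<in> l}"
    by (simp add: grid_points_def)
  ultimately show ?thesis
    using card_inj_on_le[of ?f "{..<N}"] by simp
qed

text \<open>Containment in a given plane is one linear equation between the slopes \<open>a, c\<close> and one
  between the offsets \<open>b, d\<close>, with the same coefficients \<open>\<alpha>, \<beta>\<close>. These cannot both vanish, so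
  one slope and the corresponding offset determine the line.\<close>

lemma card_grid_lines_in_plane:
  assumes "is_plane H"
  shows "card {l \<in> grid_lines A N. l \<subseteq> H} \<le> A^2 * N"
proof -
  obtain \<alpha> \<beta> \<gamma> \<delta> where H: "H = {p. \<alpha> * p$1 + \<beta> * p$2 + \<gamma> * p$3 = \<delta>}"
    and nz: "\<alpha> \<noteq> 0 \<or> \<beta> \<noteq> 0 \<or> \<gamma> \<noteq> 0"
    by (rule is_plane_equation[OF assms])
  define Q where "Q = {u \<in> grid_coeffs A N. coeff_line u \<subseteq> H}"
  have in_H: "\<alpha> * a + \<beta> * c + \<gamma> = 0 \<and> \<alpha> * b + \<beta> * d = \<delta>" if "(a, b, c, d) \<in> Q" for a b c d
    using that by (simp add: Q_def coeff_line_def H graph_line_subset_plane_iff)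
  have finQ: "finite Q" by (simp add: Q_def grid_coeffs_def)
  have "card Q \<le> card ({..<A} \<times> {..<A*N})"
  proof (cases "\<alpha> = 0")
    case False
    have "inj_on (\<lambda>u. snd (snd u)) Q"
    proof (rule inj_onI)
      fix u u' assume u: "u \<in> Q" "u' \<in> Q" "(\<lambda>u. snd (snd u)) u = (\<lambda>u. snd (snd u)) u'"
      obtain a b c d where abcd: "u = (a, b, c, d)" by (cases u)
      obtain a' b' c' d' where abcd': "u' = (a', b', c', d')" by (cases u')
      have eqs: "c = c'" "d = d'" using u(3) by (simp_all add: abcd abcd')
      note lin = in_H[OF u(1)[unfolded abcd]] in_H[OF u(2)[unfolded abcd']]
      have "\<alpha> * a = \<alpha> * a'" "\<alpha> * b = \<alpha> * b'"
        using lin unfolding eqs by linarith+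
      then have "a = a'" "b = b'" using False by simp_all
      then show "u = u'" using eqs by (simp add: abcd abcd')
    qed
    moreover have "(\<lambda>u. snd (snd u)) ` Q \<subseteq> {..<A} \<times> {..<A*N}"
      by (auto simp: Q_def grid_coeffs_def)
    ultimately show ?thesis by (rule card_inj_on_le) simp
  next
    case True
    have "inj_on (\<lambda>u. (fst u, fst (snd u))) Q"
    proof (rule inj_onI)
      fix u u' assume u: "u \<in> Q" "u' \<in> Q" "(\<lambda>u. (fst u, fst (snd u))) u = (\<lambda>u. (fst u, fst (snd u))) u'"
      obtain a b c d where abcd: "u = (a, b, c, d)" by (cases u)
      obtain a' b' c' d' where abcd': "u' = (a', b', c', d')" by (cases u')
      have eqs: "a = a'" "b = b'" using u(3) by (simp_all add: abcd abcd')
      note lin = in_H[OF u(1)[unfolded abcd]] in_H[OF u(2)[unfolded abcd']]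
      have "\<beta> * c = \<beta> * c'" "\<beta> * d = \<beta> * d'"
        using lin unfolding eqs by linarith+
      moreover have "\<beta> \<noteq> 0" using lin nz True by auto
      ultimately have "c = c'" "d = d'" by simp_all
      then show "u = u'" using eqs by (simp add: abcd abcd')
    qed
    moreover have "(\<lambda>u. (fst u, fst (snd u))) ` Q \<subseteq> {..<A} \<times> {..<A*N}"
      by (auto simp: Q_def grid_coeffs_def)
    ultimately show ?thesis by (rule card_inj_on_le) simp
  qed
  moreover have "{l \<in> grid_lines A N. l \<subseteq> H} = coeff_line ` Q"
    by (auto simp: grid_lines_def Q_def)
  ultimately show ?thesis
    using card_image_le[OF finQ, of coeff_line] by (simp add: power2_eq_square)
qed

section \<open>Padding an arrangement to prescribed size\<close>

text \<open>A finite union of lines has measure zero, so it cannot miss only finitely many points.\<close>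

lemma infinite_complement_of_finitely_many_lines:
  fixes L :: "'a::euclidean_space set set"
  assumes "finite L" "\<forall>l\<in>L. is_line l" "2 \<le> DIM('a)"
  shows "infinite (- \<Union>L)"
proof
  assume "finite (- \<Union>L)"
  then have "negligible (- \<Union>L)" by (rule negligible_finite)
  moreover have "negligible l" if "l \<in> L" for l
  proof -
    have "aff_dim l < int DIM('a)" using assms that by (auto simp: is_line_def)
    then obtain a b where "a \<noteq> 0" "l \<subseteq> {x. a \<bullet> x = b}"
      using aff_lowdim_subset_hyperplane by blast
    then show ?thesis using negligible_hyperplane negligible_subset by blast
  qed
  then have "negligible (\<Union>L)" using assms(1) by (intro negligible_Union) auto
  ultimately have "negligible (- \<Union>L \<union> \<Union>L)" by (rule negligible_Un)
  then show False by simp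
qed

text \<open>One of the two rulings of the quadric \<open>z = xy\<close>: its lines are pairwise skew.\<close>

definition ruling_line :: "real \<Rightarrow> (real^3) set" where
  "ruling_line s = {p. p$1 = s \<and> p$3 = s * p$2}"

lemma is_line_ruling_line: "is_line (ruling_line s)"
proof -
  have "ruling_line s = range (\<lambda>t. vector [s, 0, 0] + t *\<^sub>R vector [0, 1, s])"
  proof (intro equalityI subsetI)
    fix p assume "p \<in> ruling_line s"
    then have "p = vector [s, 0, 0] + p$2 *\<^sub>R vector [0, 1, s]"
      by (simp add: ruling_line_def vec_eq_iff forall_3 vector_3)
    then show "p \<in> range (\<lambda>t. vector [s, 0, 0] + t *\<^sub>R vector [0, 1, s])" by blast
  qed (auto simp: ruling_line_def vector_3)
  moreover have "vector [0, 1, s] \<noteq> (0 :: real^3)"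
    by (simp add: vec_eq_iff forall_3 vector_3)
  ultimately show ?thesis using is_line_range by metis
qed

lemma ruling_lines_not_coplanar:
  assumes "is_plane H" "ruling_line s \<subseteq> H" "ruling_line s' \<subseteq> H"
  shows "s = s'"
proof (rule ccontr)
  assume neq: "s \<noteq> s'"
  obtain \<alpha> \<beta> \<gamma> \<delta> where H: "H = {p. \<alpha> * p$1 + \<beta> * p$2 + \<gamma> * p$3 = \<delta>}"
    and nz: "\<alpha> \<noteq> 0 \<or> \<beta> \<noteq> 0 \<or> \<gamma> \<noteq> 0"
    by (rule is_plane_equation[OF assms(1)])
  have eqs: "\<alpha> * u = \<delta> \<and> \<beta> + \<gamma> * u = 0" if "ruling_line u \<subseteq> H" for u
  proof -
    have "vector [u, 0, 0] \<in> H" "vector [u, 1, u] \<in> H"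
      using that by (auto simp: ruling_line_def vector_3)
    then show ?thesis by (auto simp: H vector_3)
  qed
  have "\<alpha> * s = \<alpha> * s'" "\<gamma> * s = \<gamma> * s'"
    using eqs[OF assms(2)] eqs[OF assms(3)] by linarith+
  then have "\<alpha> = 0" "\<gamma> = 0" using neq by auto
  then show False using eqs[OF assms(2)] nz by auto
qed

lemma inj_ruling_line: "inj ruling_line"
proof (rule injI)
  fix s s' assume "ruling_line s = ruling_line s'"
  moreover have "vector [s, 0, 0] \<in> ruling_line s" by (simp add: ruling_line_def vector_3)
  ultimately have "vector [s, 0, 0] \<in> ruling_line s'" by simp
  then show "s = s'" by (simp add: ruling_line_def vector_3)
qed

text \<open>The new lines come from the ruling, all but finitely many members of which miss the given
  points; the new points are then taken off all lines. Thus nothing new takes part in an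
  incidence.\<close>

lemma pad_arrangement:
  fixes P0 :: "(real^3) set"
  assumes arr: "arrangement P0 L0" and "card P0 \<le> m" "card L0 \<le> n"
  obtains P L where "arrangement P L" "P0 \<subseteq> P" "L0 \<subseteq> L" "card P = m" "card L = n"
    "\<forall>p\<in>P. \<forall>l\<in>L. p \<in> l \<longrightarrow> p \<in> P0 \<and> l \<in> L0"
    "\<forall>H. is_plane H \<longrightarrow> card {l \<in> L. l \<subseteq> H} \<le> card {l \<in> L0. l \<subseteq> H} + 1"
proof -
  have fin: "finite P0" "finite L0" and lines: "\<forall>l\<in>L0. is_line l"
    using arr by (auto simp: arrangement_def)
  \<comment> \<open>\<open>ruling_line s\<close> lies in the plane \<open>x = s\<close>, so it meets \<open>P0\<close> only if \<open>s\<close> is a first coordinate there.\<close>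
  let ?bad = "(\<lambda>p. p$1) ` P0 \<union> ruling_line -` L0"
  have "finite ?bad"
    using fin inj_ruling_line by (auto intro: finite_vimageI)
  then have "infinite (- ?bad)" using infinite_UNIV_char_0 by (metis finite_compl)
  then obtain R where R: "R \<subseteq> - ?bad" "finite R" "card R = n - card L0"
    by (meson infinite_arbitrarily_large)
  define L where "L = L0 \<union> ruling_line ` R"
  have finL: "finite L" and linesL: "\<forall>l\<in>L. is_line l"
    using fin R lines is_line_ruling_line by (auto simp: L_def)
  have cardL: "card L = n"
  proof -
    have "card L = card L0 + card (ruling_line ` R)"
      unfolding L_def using fin R by (intro card_Un_disjoint) auto
    also have "card (ruling_line ` R) = card R"
      using inj_ruling_line by (intro card_image) (simp add: inj_on_def)
    finally show ?thesis using R assms(3) by simp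
  qed
  have "infinite (- \<Union>L)" using infinite_complement_of_finitely_many_lines[OF finL linesL] by simp
  then have "infinite (- \<Union>L - P0)" using fin(1) by (rule Diff_infinite_finite[rotated])
  then obtain Q where Q: "Q \<subseteq> - \<Union>L - P0" "finite Q" "card Q = m - card P0"
    by (meson infinite_arbitrarily_large)
  have cardP: "card (P0 \<union> Q) = m"
    using Q fin assms(2) by (subst card_Un_disjoint) auto
  show ?thesis
  proof (rule that[of "P0 \<union> Q" L])
    show "arrangement (P0 \<union> Q) L"
      using fin Q finL linesL by (auto simp: arrangement_def)
    have "p \<in> P0 \<and> l \<in> L0" if "p \<in> P0 \<union> Q" "l \<in> L" "p \<in> l" for p l
    proof -
      have p: "p \<in> P0" using that Q(1) by blast
      moreover have "p \<notin> ruling_line s" if "s \<in> R" for s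
        using p that R(1) by (auto simp: ruling_line_def)
      ultimately show ?thesis using that by (auto simp: L_def)
    qed
    then show "\<forall>p\<in>P0 \<union> Q. \<forall>l\<in>L. p \<in> l \<longrightarrow> p \<in> P0 \<and> l \<in> L0" by blast
    have "card {l \<in> L. l \<subseteq> H} \<le> card {l \<in> L0. l \<subseteq> H} + 1" if H: "is_plane H" for H
    proof -
      let ?N = "{l \<in> ruling_line ` R. l \<subseteq> H}"
      have "finite ?N" using R by simp
      moreover have "\<forall>l\<in>?N. \<forall>l'\<in>?N. l = l'"
        using ruling_lines_not_coplanar[OF H] by blast
      ultimately have "card ?N \<le> 1"
        unfolding One_nat_def by (rule iffD2[OF card_le_Suc0_iff_eq])
      moreover have "{l \<in> L. l \<subseteq> H} = {l \<in> L0. l \<subseteq> H} \<union> ?N" by (auto simp: L_def)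
      ultimately show ?thesis
        using card_Un_le[of "{l \<in> L0. l \<subseteq> H}" ?N] by simp
    qed
    then show "\<forall>H. is_plane H \<longrightarrow> card {l \<in> L. l \<subseteq> H} \<le> card {l \<in> L0. l \<subseteq> H} + 1"
      by blast
  qed (use cardP cardL in \<open>auto simp: L_def\<close>)
qed

section \<open>Choice of parameters\<close>

text \<open>Up to constants, \<open>A\<^sup>2N = n\<^sup>1\<^sup>/\<^sup>2\<close> and \<open>A\<^sup>2N\<^sup>3 = m\<close> force \<open>N = u\<close> with \<open>u = m\<^sup>1\<^sup>/\<^sup>2 n\<^sup>-\<^sup>1\<^sup>/\<^sup>4\<close> and
  \<open>A\<^sup>2 = n\<^sup>1\<^sup>/\<^sup>2 / u\<close>. The hypothesis \<open>n\<^sup>1\<^sup>/\<^sup>2 \<le> m\<close> says \<open>u \<ge> 1\<close>, so rounding \<open>u\<close> up costs at most a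
  factor 2, and \<open>m \<le> n\<close> says \<open>u \<le> n\<^sup>1\<^sup>/\<^sup>4\<close>, so \<open>A\<close> is at least of order \<open>n\<^sup>1\<^sup>/\<^sup>8\<close>.\<close>

lemma exists_grid_parameters:
  fixes m n :: nat
  assumes "2 ^ 20 \<le> n" "sqrt n \<le> m" "m \<le> n"
  obtains A N :: nat where "4 * A^2 * N^3 \<le> m" "A^4 * N^2 \<le> n" "A^2 * N + 1 \<le> sqrt n"
    "m powr (1/2) * n powr (3/4) \<le> 16384 * (A^4 * N^3)"
proof -
  define w where "w = sqrt (sqrt n)"
  define u where "u = sqrt m / w"
  have w2: "w^2 = sqrt n" by (simp add: w_def)
  then have "(w^2)^2 = n" by simp
  then have w4: "w^4 = n" by (simp flip: power_mult)
  have w32: "32 \<le> w"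
  proof -
    have "real (2^20) \<le> real n" using assms(1) of_nat_le_iff by blast
    then have "(32::real) ^ Suc 3 \<le> w ^ Suc 3" by (simp add: w4)
    then show ?thesis by (rule power_le_imp_le_base) (simp add: w_def)
  qed
  have u1: "1 \<le> u"
  proof -
    have "w \<le> sqrt m" unfolding w_def using assms(2) by simp
    then show ?thesis using w32 by (simp add: u_def)
  qed
  have uw: "u \<le> w"
  proof -
    have "sqrt m \<le> w^2" using assms(3) by (simp add: w2)
    then show ?thesis using w32 by (simp add: u_def field_simps power2_eq_square)
  qed
  have m_eq: "m = u^2 * w^2" using w32 by (simp add: u_def power_divide)
  \<comment> \<open>With \<open>N \<le> 2u\<close> the point count is at most \<open>4 v\<^sup>2 (2u)\<^sup>3 = 32 u v\<^sup>2 u\<^sup>2\<close>; the factor 32 makes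
    this exactly \<open>m\<close>.\<close>
  define v where "v = w / sqrt (32 * u)"
  have v2: "v^2 = w^2 / (32 * u)" using u1 by (simp add: v_def power_divide)
  have v1: "1 \<le> v"
  proof -
    have "32 * u \<le> w * w" using w32 uw u1 by (intro mult_mono) auto
    then have "1 \<le> v^2" using u1 unfolding v2 by (simp add: field_simps power2_eq_square)
    moreover have "0 \<le> v" using w32 u1 by (simp add: v_def)
    ultimately show ?thesis using power2_le_imp_le[of 1 v] by simp
  qed
  define N where "N = nat \<lceil>u\<rceil>"
  define A where "A = nat \<lfloor>v\<rfloor>"
  have N: "u \<le> N" "N \<le> 2 * u" using u1 unfolding N_def by linarith+
  have A: "v / 2 \<le> A" "A \<le> v" 
  proof -
    have "1 \<le> \<lfloor>v\<rfloor>" using v1 by simp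
    then have "real A = of_int \<lfloor>v\<rfloor>" "1 \<le> real A" by (simp_all add: A_def)
    then show "v / 2 \<le> A" "A \<le> v" by linarith+
  qed
  have A2: "real A^2 \<le> v^2" using A by (intro power_mono) auto
  have plane: "real (A^2 * N) \<le> w^2 / 16"
  proof -
    have "real A^2 * N \<le> v^2 * (2 * u)" using A2 N u1 by (intro mult_mono) auto
    also have "\<dots> = w^2 / 16" using u1 by (simp add: v2)
    finally show ?thesis by simp
  qed
  have w2big: "32 * 32 \<le> w^2"
    using mult_mono[OF w32 w32] w32 by (simp add: power2_eq_square)
  show ?thesis
  proof
    have "real N^3 \<le> (2 * u)^3" using N by (intro power_mono) auto
    then have "4 * real A^2 * real N^3 \<le> 4 * v^2 * (2 * u)^3"
      using A2 u1 by (intro mult_mono) auto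
    also have "\<dots> = m"
      using u1 unfolding v2 m_eq by (simp add: power3_eq_cube power2_eq_square)
    finally show "4 * A^2 * N^3 \<le> m"
      by (simp flip: of_nat_le_iff[where 'a=real])
    show "A^2 * N + 1 \<le> sqrt n"
      using plane w2big by (simp flip: w2)
    have "real (A^2 * N)^2 \<le> (w^2)^2"
      using plane w2big by (intro power_mono) auto
    then show "A^4 * N^2 \<le> n"
      by (simp add: w4 power_mult_distrib flip: power_mult of_nat_le_iff[where 'a=real])
    have "m powr (1/2) = u * w"
      using m_eq u1 w32 by (simp add: powr_half_sqrt real_sqrt_mult)
    moreover have "n powr (3/4) = w^3"
    proof -
      have "n powr (3/4) = (w powr 4) powr (3/4)"
        using w4 w32 by (simp add: powr_numeral)
      also have "\<dots> = w powr 3" by (simp add: powr_powr)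
      also have "\<dots> = w^3" using w32 by (simp add: powr_numeral)
      finally show ?thesis .
    qed
    moreover have "u * w * w^3 = 16384 * ((v / 2)^4 * u^3)"
    proof -
      have "(v/2)^4 = (v^2)^2 / 16" by (simp add: power_divide flip: power_mult)
      then show ?thesis using u1 unfolding v2
        by (simp add: power_divide power_mult_distrib power2_eq_square power3_eq_cube)
    qed
    moreover have "(v / 2)^4 * u^3 \<le> real A^4 * real N^3"
      using A N u1 v1 by (intro mult_mono power_mono) auto
    ultimately show "m powr (1/2) * n powr (3/4) \<le> 16384 * (A^4 * N^3)"
      by simp
  qed
qed

text \<open>The exponent \<open>4/k\<close> is large enough because \<open>(4/k) (k(k-1)/2 - 1) > k\<close> reduces to
  \<open>k(k-2) > 4\<close>.\<close>

lemma exists_colour_number: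
  fixes m k :: nat
  assumes "4 \<le> k" "2 \<le> m"
  obtains t :: nat where "0 < t" "t \<le> 2 * m powr (4 / k)" "m ^ k < t ^ ((k choose 2) - 1)"
proof -
  let ?x = "real m powr (4 / k)"
  define t where "t = nat \<lceil>?x\<rceil>"
  define q where "q = (k choose 2) - 1"
  have x1: "1 \<le> ?x" using assms by (intro ge_one_powr_ge_zero) auto
  have t: "?x \<le> t" "t \<le> 2 * ?x" using x1 unfolding t_def by linarith+
  have q: "real q = (real k * (real k - 1)) / 2 - 1"
  proof -
    have "1 \<le> k choose 2" using assms by (simp add: Suc_le_eq)
    moreover have "real (k choose 2) = real k * (real k - 1) / 2"
      using assms by (simp add: choose_two real_of_nat_div of_nat_diff)
    ultimately show ?thesis by (simp add: q_def of_nat_diff)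
  qed
  have "real k < 4 / k * q"
  proof -
    have "4 * (real k - 2) \<le> real k * (real k - 2)" using assms by (intro mult_right_mono) auto
    then show ?thesis using assms by (simp add: q field_simps)
  qed
  then have "real m ^ k < real m powr (4 / k * q)"
    using assms by (simp add: powr_realpow[symmetric])
  also have "\<dots> = ?x ^ q"
    using x1 assms by (simp add: powr_powr flip: powr_realpow)
  also have "\<dots> \<le> real t ^ q" using t x1 by (intro power_mono) auto
  finally have "m ^ k < t ^ q" by (simp flip: of_nat_less_iff[where 'a=real])
  moreover have "0 < t" using x1 t(1) by linarith
  ultimately show ?thesis using that t(2) by (simp add: q_def)
qed

section \<open>Many incidences without cliques in general position\<close>

lemma card_incidences_ge:
  assumes "finite P" "finite L" "\<And>l. l \<in> L \<Longrightarrow> r \<le> card {p \<in> P. p \<in> l}"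
  shows "card L * r \<le> card (incidences P L)"
proof -
  have "card (incidences P L) = card (Sigma L (\<lambda>l. {p \<in> P. p \<in> l}))"
    by (rule bij_betw_same_card[of prod.swap])
       (auto simp: bij_betw_def inj_on_def incidences_def image_iff)
  also have "\<dots> = (\<Sum>l\<in>L. card {p \<in> P. p \<in> l})"
    using assms by (intro card_SigmaI) auto
  also have "\<dots> \<ge> (\<Sum>l\<in>L. r)" using assms by (intro sum_mono) auto
  finally show ?thesis by simp
qed

theorem theorem1p4:
  shows "\<exists>C::real. C > 0 \<and>
    (\<forall>k::nat. k \<ge> 4 \<longrightarrow>
      (\<exists>n0::nat. \<forall>m n :: nat. m \<ge> n0 \<longrightarrow> n \<ge> n0 \<longrightarrow> sqrt (real n) \<le> real m \<longrightarrow> m \<le> n \<longrightarrow>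
        (\<exists>(P :: (real ^ 3) set) (L :: (real ^ 3) set set).
           arrangement P L \<and> card P = m \<and> card L = n \<and>
           \<not> (\<exists>T. is_clique k P L T \<and> general_position T) \<and>
           (\<forall>H. is_plane H \<longrightarrow> real (card {l \<in> L. l \<subseteq> H}) \<le> sqrt (real n)) \<and>
           real (card (incidences P L)) > real m powr (1 / 2 - C / real k) * real n powr (3 / 4))))"
proof (intro exI[of _ "5::real"] conjI allI impI)
  fix k :: nat assume k: "4 \<le> k"
  show "\<exists>n0::nat. \<forall>m n :: nat. m \<ge> n0 \<longrightarrow> n \<ge> n0 \<longrightarrow> sqrt (real n) \<le> real m \<longrightarrow> m \<le> n \<longrightarrow>
        (\<exists>(P :: (real ^ 3) set) (L :: (real ^ 3) set set).
           arrangement P L \<and> card P = m \<and> card L = n \<and>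
           \<not> (\<exists>T. is_clique k P L T \<and> general_position T) \<and>
           (\<forall>H. is_plane H \<longrightarrow> real (card {l \<in> L. l \<subseteq> H}) \<le> sqrt (real n)) \<and>
           real (card (incidences P L)) > real m powr (1 / 2 - 5 / real k) * real n powr (3 / 4))"
  \<comment> \<open>Beyond this bound \<open>m\<^sup>1\<^sup>/\<^sup>k\<close> exceeds \<open>32768 = 2 * 16384\<close>, the factors lost in rounding the
    number of colours and the grid parameters.\<close>
  proof (intro exI[of _ "32768 ^ k + 1"] allI impI)
    fix m n :: nat
    assume m: "32768 ^ k + 1 \<le> m" and n: "32768 ^ k + 1 \<le> n"
      and mn: "sqrt n \<le> m" "m \<le> n"
    have big: "(2::nat) ^ 20 \<le> 32768 ^ k"
    proof -
      have "(32768::nat) ^ 4 \<le> 32768 ^ k" using k by (intro power_increasing) auto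
      then show ?thesis by simp
    qed
    obtain A N :: nat where AN: "4 * A^2 * N^3 \<le> m" "A^4 * N^2 \<le> n" "A^2 * N + 1 \<le> sqrt n"
      "m powr (1/2) * n powr (3/4) \<le> 16384 * (A^4 * N^3)"
      using exists_grid_parameters[of n m] big n mn by auto
    obtain t :: nat where t: "0 < t" "t \<le> 2 * m powr (4 / k)" "m ^ k < t ^ ((k choose 2) - 1)"
      using exists_colour_number[OF k, of m] big m by auto
    let ?G = "grid_points A N"
    have cardG: "card ?G \<le> m" using card_grid_points_le AN(1) le_trans by blast
    then have "card ?G ^ k < t ^ ((k choose 2) - 1)"
      using t(3) power_mono[of "card ?G" m k] by linarith
    then obtain L0 where L0: "L0 \<subseteq> grid_lines A N" "card (grid_lines A N) \<le> t * card L0"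
      and free: "\<And>T. is_clique k ?G L0 T \<Longrightarrow> \<not> general_position T"
      using exists_clique_free_sublines[OF arrangement_grid, of k A N t] k t(1) by auto
    have finG: "finite (grid_lines A N)" using arrangement_grid by (simp add: arrangement_def)
    have arr0: "arrangement ?G L0"
      using arrangement_grid[of A N] L0(1) finite_subset unfolding arrangement_def by blast
    have "card L0 \<le> n"
      using card_mono[OF finG L0(1)] AN(2) card_grid_lines by (metis le_trans)
    then obtain P L where PL: "arrangement P L" "?G \<subseteq> P" "L0 \<subseteq> L" "card P = m" "card L = n"
      and inc: "\<forall>p\<in>P. \<forall>l\<in>L. p \<in> l \<longrightarrow> p \<in> ?G \<and> l \<in> L0"
      and plane: "\<forall>H. is_plane H \<longrightarrow> card {l \<in> L. l \<subseteq> H} \<le> card {l \<in> L0. l \<subseteq> H} + 1"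
      by (rule pad_arrangement[OF arr0 cardG])
    have no_clique: "\<not> general_position T" if T: "is_clique k P L T" for T
    proof (rule free)
      have "T \<subseteq> ?G"
      proof
        fix p assume p: "p \<in> T"
        have "2 \<le> card T" using T k by (simp add: is_clique_def)
        then have "\<not> T \<subseteq> {p}" using card_mono[of "{p}" T] by auto
        then obtain q where "q \<in> T" "q \<noteq> p" by blast
        then show "p \<in> ?G" using T p inc unfolding is_clique_def by (metis subsetD)
      qed
      then show "is_clique k ?G L0 T"
        using T inc unfolding is_clique_def by (metis subsetD)
    qed
    have coplanar: "card {l \<in> L. l \<subseteq> H} \<le> sqrt n" if H: "is_plane H" for H
    proof -
      have "card {l \<in> L0. l \<subseteq> H} \<le> card {l \<in> grid_lines A N. l \<subseteq> H}"
        using L0(1) finG by (intro card_mono) auto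
      then have "card {l \<in> L. l \<subseteq> H} \<le> A^2 * N + 1"
        using plane[rule_format, OF H] card_grid_lines_in_plane[OF H, of A N] by linarith
      then have "real (card {l \<in> L. l \<subseteq> H}) \<le> A^2 * N + 1"
        by (metis of_nat_1 of_nat_add of_nat_le_iff)
      then show ?thesis using AN(3) by linarith
    qed
    have incidence_bound: "m powr (1/2 - 5/k) * n powr (3/4) < card (incidences P L)"
    proof -
      have fin: "finite ?G" "finite L0" "finite P" "finite L"
        using arr0 PL(1) by (auto simp: arrangement_def)
      have "incidences ?G L0 \<subseteq> incidences P L"
        using PL by (auto simp: incidences_def)
      moreover have "finite (incidences P L)"
        using fin finite_subset[of "incidences P L" "P \<times> L"] by (auto simp: incidences_def)
      moreover have "card L0 * N \<le> card (incidences ?G L0)"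
        using fin L0(1) card_grid_points_on_line by (intro card_incidences_ge) auto
      ultimately have I: "card L0 * N \<le> card (incidences P L)"
        by (meson card_mono le_trans)
      have "A^4 * N^3 = card (grid_lines A N) * N"
        by (simp add: card_grid_lines power2_eq_square power3_eq_cube)
      also have "\<dots> \<le> t * card L0 * N" using L0(2) by (rule mult_right_mono) simp
      also have "\<dots> \<le> t * card (incidences P L)"
        using I by (simp add: mult.assoc)
      finally have AI: "real (A^4 * N^3) \<le> t * real (card (incidences P L))"
        by (metis of_nat_le_iff of_nat_mult)
      let ?x = "real m powr (1/k)" and ?M = "real m powr (1/2 - 5/k) * n powr (3/4)"
      have m0: "0 < real m" "0 < real n" using m n by auto
      have x: "32768 < ?x"
      proof -
        have "real (32768 ^ k) < real m" using m by (subst of_nat_less_iff) linarith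
        then have "(32768 ^ k) powr (1/k) < ?x"
          using k by (intro powr_less_mono2) auto
        then show ?thesis using k by (simp add: powr_powr flip: powr_realpow)
      qed
      have M: "0 < ?M" using m0 by simp
      have "m powr (4/k) * 32768 * ?M < m powr (4/k) * ?x * ?M"
        using x M m0 by (intro mult_strict_right_mono mult_strict_left_mono) auto
      also have "\<dots> = m powr (4/k + 1/k + (1/2 - 5/k)) * n powr (3/4)"
        by (simp only: powr_add mult.assoc)
      also have "4/k + 1/k + (1/2 - 5/k) = (1/2::real)"
        by simp
      also have "m powr (1/2) * n powr (3/4) \<le> 16384 * (t * real (card (incidences P L)))"
        using AN(4) AI by linarith
      also have "\<dots> \<le> 16384 * (2 * m powr (4/k) * card (incidences P L))"
        using t(2) by (intro mult_left_mono mult_right_mono) auto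
      finally have "m powr (4/k) * ?M < m powr (4/k) * card (incidences P L)"
        by (simp add: ac_simps)
      then show ?thesis using m0 by simp
    qed
    show "\<exists>(P :: (real ^ 3) set) (L :: (real ^ 3) set set).
           arrangement P L \<and> card P = m \<and> card L = n \<and>
           \<not> (\<exists>T. is_clique k P L T \<and> general_position T) \<and>
           (\<forall>H. is_plane H \<longrightarrow> real (card {l \<in> L. l \<subseteq> H}) \<le> sqrt (real n)) \<and>
           real (card (incidences P L)) > real m powr (1 / 2 - 5 / real k) * real n powr (3 / 4)"
      using PL no_clique coplanar incidence_bound by blast
  qed
qed simp

end
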